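(* Let $k\ge 3$ be an integer. Then $2\le \chi(k^2,k)\le 3$.
   Context: For positive integers $k,N,d$ with $k\ge 3$, a $k$-term cyclic arithmetic progression mod $N$ with common difference $d$ is a $k$-element subset of $\mathbb{Z}_N=\mathbb{Z}/N\mathbb{Z}$ of the form $\{t,t+d,\ldots,t+(k-1)d\}$ for some $t\in\mathbb{Z}_N$ (so these $k$ elements are pairwise distinct mod $N$). $\chi(N,k)$ denotes the minimum number of subsets necessary to partition $\mathbb{Z}_N$ such that no subset in the partition contains any $k$-term cyclic arithmetic progression mod $N$. *)

theory Defs
  imports Main "HOL-Library.Disjoint_Sets"
begin

text \<open>
  The cyclic group of integers mod \<open>N\<close> (\<open>N > 0\<close>) is represented by the residues \<open>{0..<N}\<close>,
  with sums reduced mod \<open>N\<close>.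
\<close>

definition cyclic_AP :: "nat \<Rightarrow> nat \<Rightarrow> nat \<Rightarrow> nat set \<Rightarrow> bool" where
  "cyclic_AP N k d A \<longleftrightarrow>
     card A = k \<and> (\<exists>t\<in>{0..<N}. A = (\<lambda>i. (t + i * d) mod N) ` {0..<k})"

definition AP_free_partition :: "nat \<Rightarrow> nat \<Rightarrow> nat set set \<Rightarrow> bool" where
  "AP_free_partition N k P \<longleftrightarrow>
     partition_on {0..<N} P \<and>
     (\<forall>S\<in>P. \<not> (\<exists>d>0. \<exists>A. cyclic_AP N k d A \<and> A \<subseteq> S))"

definition chi :: "nat \<Rightarrow> nat \<Rightarrow> nat" where
  "chi N k = (LEAST r. \<exists>P. AP_free_partition N k P \<and> card P = r)"

text \<open>
  For \<open>k \<ge> 2\<close> the partition into singletons is admissible, so the minimum in \<^const>\<open>chi\<close> is attained.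
\<close>

lemma AP_free_partition_singletons:
  assumes "k \<ge> 2"
  shows "AP_free_partition N k ((\<lambda>x. {x}) ` {0..<N})"
proof -
  have "partition_on {0..<N} ((\<lambda>x. {x}) ` {0..<N})"
    by (rule partition_onI) (auto simp: disjnt_def)
  moreover have "\<not> A \<subseteq> {x}" if "cyclic_AP N k d A" for A d x
  proof
    assume "A \<subseteq> {x}"
    then have "card A \<le> 1"
      using card_mono[of "{x}" A] by simp
    then show False
      using that assms by (simp add: cyclic_AP_def)
  qed
  ultimately show ?thesis
    unfolding AP_free_partition_def by blast
qed

end

theory Submission
  imports Defs "HOL-Number_Theory.Cong"
begin

text \<open>
  Arrange the residues mod \<open>k\<^sup>2\<close> in columns according to their residue mod \<open>k\<close>, and colour with
  \<open>0, 1, 2\<close>.  Each column has one main colour, \<open>0\<close> in the left half and \<open>1\<close> in the right half, with a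
  single exception in the bottom row: the exceptional colour is \<open>2\<close> in the two outermost columns
  and the opposite main colour elsewhere.  Let \<open>g = gcd d k\<close>.  A progression with difference \<open>d\<close> meets
  the \<open>k / g\<close> columns of a residue class mod \<open>g\<close>, each \<open>g\<close> times.  If \<open>g = 1\<close> it meets both outermost
  columns, which share only the colour \<open>2\<close>.  If \<open>1 < g < k\<close> it takes the main colour in every
  column it meets, and it meets both halves.  If \<open>g = k\<close> it is a full column and contains the
  exception.  Colour \<open>2\<close> is used only twice.
\<close>

lemma chi_le_coloring:
  fixes col :: "nat \<Rightarrow> nat"
  assumes col: "\<And>x. x < N \<Longrightarrow> col x < r"
    and free: "\<And>c d A. d > 0 \<Longrightarrow> cyclic_AP N k d A \<Longrightarrow> A \<subseteq> {x. x < N \<and> col x = c} \<Longrightarrow> False"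
  shows "chi N k \<le> r"
proof -
  \<comment> \<open>Colours that never occur give empty classes, which a partition may not contain.
    Removing them only lowers the number of parts, so an upper bound survives.\<close>
  define P where "P = (\<lambda>c. {x. x < N \<and> col x = c}) ` {..<r} - {{}}"
  have "partition_on {0..<N} P"
  proof (rule partition_onI)
    show "\<Union> P = {0..<N}"
    proof (intro equalityI subsetI)
      fix x assume "x \<in> {0..<N}"
      then show "x \<in> \<Union> P"
        unfolding P_def using col by (intro UnionI[of "{y. y < N \<and> col y = col x}"]) auto
    qed (auto simp: P_def)
  qed (auto simp: P_def disjnt_def)
  then have "AP_free_partition N k P"
    unfolding AP_free_partition_def using free by (auto simp: P_def)
  then have "chi N k \<le> card P"
    unfolding chi_def by (auto intro: Least_le)
  also have "card P \<le> card ((\<lambda>c. {x. x < N \<and> col x = c}) ` {..<r})"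
    unfolding P_def by (rule card_mono) auto
  also have "\<dots> \<le> r"
    using card_image_le[of "{..<r}"] by simp
  finally show ?thesis .
qed

lemma cyclic_AP_interval:
  assumes "0 < k" "k \<le> N"
  shows "cyclic_AP N k 1 {0..<k}"
proof -
  have "(\<lambda>i. (0 + i * 1) mod N) ` {0..<k} = (\<lambda>i. i) ` {0..<k}"
    by (rule image_cong) (use assms in auto)
  then show ?thesis
    using assms unfolding cyclic_AP_def by (auto intro!: bexI[of _ 0])
qed

text \<open>A single part would be all of \<open>{0..<N}\<close>, which contains the progression
  \<open>0, ..., k - 1\<close> of difference 1.\<close>

lemma two_le_chi:
  assumes "2 \<le> k" "k \<le> N"
  shows "2 \<le> chi N k"
proof -
  have "\<exists>P. AP_free_partition N k P \<and> card P = chi N k"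
    unfolding chi_def by (rule LeastI_ex) (use AP_free_partition_singletons[OF assms(1)] in blast)
  then obtain P where P: "AP_free_partition N k P" "card P = chi N k"
    by blast
  have part: "partition_on {0..<N} P"
    using P(1) by (simp add: AP_free_partition_def)
  have "finite P"
    using finite_elements[OF _ part] by simp
  moreover have "P \<noteq> {}"
    using part assms by (auto simp: partition_on_def)
  ultimately have "card P \<noteq> 0"
    by simp
  moreover have "card P \<noteq> 1"
  proof
    assume "card P = 1"
    then obtain S where "P = {S}"
      by (auto simp: card_1_singleton_iff)
    then have "S = {0..<N}" "S \<in> P"
      using part by (auto simp: partition_on_def)
    moreover have "{0..<k} \<subseteq> {0..<N}"
      using assms by auto
    moreover have "cyclic_AP N k 1 {0..<k}"
      using assms by (intro cyclic_AP_interval) auto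
    ultimately show False
      using P(1) unfolding AP_free_partition_def by (metis zero_less_one)
  qed
  ultimately show ?thesis
    using P(2) by linarith
qed

text \<open>By Bezout some multiple of \<open>d\<close> is congruent to \<open>gcd d k\<close> mod
  \<open>k\<close>, so the multiples of \<open>d\<close> reach every multiple of the gcd, in
  particular \<open>b - t\<close>.\<close>

lemma AP_hits_residue:
  fixes t d k b :: nat
  assumes "0 < k" "b < k" and dvd: "int (gcd d k) dvd int b - int t"
  obtains i where "i < k" "(t + i * d) mod k = b"
proof -
  obtain e where e: "int b - int t = int (gcd d k) * e"
    using dvd by (elim dvdE)
  obtain x where x: "[int d * x = gcd (int d) (int k)] (mod int k)"
    using cong_solve_int by blast
  \<comment> \<open>\<open>x * e\<close> solves the congruence over the integers; reducing it mod
    \<open>k\<close> turns it into an admissible index.\<close>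
  define i where "i = nat ((x * e) mod int k)"
  have i: "int i = (x * e) mod int k"
    using assms(1) by (simp add: i_def)
  have "int i < int k"
    unfolding i using assms(1) by simp
  have "[int i * int d = (x * e) * int d] (mod int k)"
    unfolding i cong_def by (simp add: mod_mult_left_eq)
  also have "(x * e) * int d = (int d * x) * e"
    by (simp add: mult_ac)
  also have "[(int d * x) * e = gcd (int d) (int k) * e] (mod int k)"
    using x by (intro cong_mult) auto
  also have "gcd (int d) (int k) * e = int b - int t"
    using e by simp
  finally have "[int t + int i * int d = int t + (int b - int t)] (mod int k)"
    by (intro cong_add) auto
  then have "[int (t + i * d) = int b] (mod int k)"
    by simp
  then have "[t + i * d = b] (mod k)"
    by (simp only: cong_int_iff)
  then have "(t + i * d) mod k = b"
    using assms(2) by (simp add: cong_def)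
  with \<open>int i < int k\<close> show thesis
    using that by simp
qed

text \<open>Mod \<open>k\<close> the progression repeats with a period shorter than
  \<open>k\<close>, so residue \<open>b\<close> is hit by two distinct terms. Only one number below
  \<open>k\<close> has that residue, hence one of the terms is at least \<open>k\<close>.\<close>

lemma AP_hits_residue_above:
  fixes t d k b :: nat
  assumes "0 < k" "b < k" and dvd: "int (gcd d k) dvd int b - int t"
    and g: "2 \<le> gcd d k" and kN: "k dvd N"
    and inj: "inj_on (\<lambda>i. (t + i * d) mod N) {0..<k}"
  obtains i where "i < k" "k \<le> (t + i * d) mod N" "(t + i * d) mod N mod k = b"
proof -
  obtain i where i: "i < k" "(t + i * d) mod k = b"
    using AP_hits_residue[OF assms(1-3)] .
  \<comment> \<open>This is the period of the multiples of \<open>d\<close> mod \<open>k\<close>; a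
    gcd of at least 2 makes it smaller than \<open>k\<close>, so that shifting an index by
    \<open>q\<close> mod \<open>k\<close> changes it.\<close>
  define q where "q = k div gcd d k"
  have q: "0 < q" "q < k"
    using g assms(1) by (auto simp: q_def div_greater_zero_iff dvd_imp_le)
  have "d * q = k * (d div gcd d k)"
    unfolding q_def
    by (metis dvd_div_mult gcd_dvd1 gcd_dvd2 mult.commute)
  then have dq: "k dvd q * d"
    by (simp add: mult.commute)
  define j where "j = (i + q) mod k"
  have "j < k"
    using assms(1) by (simp add: j_def)
  have "i \<noteq> j"
  proof
    assume "i = j"
    then have "[i + q = i + 0] (mod k)"
      using i(1) by (simp add: j_def cong_def)
    then have "[q = 0] (mod k)"
      by (simp only: cong_add_lcancel_nat)
    then show False
      using q by (simp add: cong_def)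
  qed
  have "[t + j * d = t + (i + q) * d] (mod k)"
    unfolding j_def by (intro cong_add cong_mult) auto
  also have "t + (i + q) * d = (t + i * d) + q * d"
    by (simp add: algebra_simps)
  also have "[(t + i * d) + q * d = (t + i * d) + 0] (mod k)"
    using dq by (intro cong_add) (auto simp: cong_0_iff)
  finally have j: "(t + j * d) mod k = b"
    using i(2) by (simp add: cong_def)
  have red: "(t + m * d) mod N mod k = (t + m * d) mod k" for m
    using kN by (simp add: mod_mod_cancel)
  have "(t + i * d) mod N \<noteq> (t + j * d) mod N"
    using inj_onD[OF inj, of i j] \<open>i \<noteq> j\<close> \<open>j < k\<close> i(1) by fastforce
  then have "k \<le> (t + i * d) mod N \<or> k \<le> (t + j * d) mod N"
    using red[of i] red[of j] i(2) j by (metis mod_less not_le)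
  then show thesis
    using that[of i] that[of j] i j \<open>j < k\<close> red by auto
qed

text \<open>Row and column of \<open>x\<close> are \<open>x div k\<close> and
  \<open>x mod k\<close>, so the bottom row is \<open>x < k\<close>. For odd \<open>k\<close> the
  middle column belongs to the right half.\<close>

definition square_coloring :: "nat \<Rightarrow> nat \<Rightarrow> nat" where
  "square_coloring k x =
    (if x < k then (if x = 0 \<or> x = k - 1 then 2 else if x < k div 2 then 1 else 0)
     else if x mod k < k div 2 then 0 else 1)"

lemma square_coloring_AP_free:
  assumes k: "3 \<le> k" and AP: "cyclic_AP (k ^ 2) k d A"
    and mono: "\<And>x. x \<in> A \<Longrightarrow> square_coloring k x = c"
  shows False
proof -
  obtain t where card: "card A = k" and A: "A = (\<lambda>i. (t + i * d) mod k ^ 2) ` {0..<k}"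
    using AP unfolding cyclic_AP_def by blast
  let ?x = "\<lambda>i. (t + i * d) mod k ^ 2"
  have inj: "inj_on ?x {0..<k}"
    using card A by (intro eq_card_imp_inj_on) auto
  have col: "square_coloring k (?x i) = c" if "i < k" for i
    using mono A that by auto
  have kN: "k dvd k ^ 2"
    by (simp add: power2_eq_square)
  have red: "?x i mod k = (t + i * d) mod k" for i
    using kN by (simp add: mod_mod_cancel)
  define g where "g = gcd d k"
  have g: "0 < g" "g dvd k" "g dvd d"
    using k by (auto simp: g_def)
  \<comment> \<open>Cells outside the bottom row always show the main colour of their
    column.\<close>
  have above: "\<exists>x\<in>A. k \<le> x \<and> x mod k = b"
    if b: "2 \<le> g" "b < k" "int g dvd int b - int t" for b
  proof -
    obtain i where "i < k" "k \<le> ?x i" "?x i mod k = b"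
      using AP_hits_residue_above[OF _ b(2) b(3)[unfolded g_def] b(1)[unfolded g_def] kN inj] k
      by auto
    then show ?thesis
      unfolding A by (intro bexI[of _ "?x i"]) auto
  qed
  have "c \<noteq> 2"
  proof
    assume "c = 2"
    have "x \<in> {0, k - 1}" if "x \<in> A" for x
      using mono[OF that] \<open>c = 2\<close> by (simp add: square_coloring_def split: if_splits)
    then have "A \<subseteq> {0, k - 1}"
      by blast
    then have "card A \<le> card {0, k - 1}"
      by (intro card_mono) auto
    then show False
      using card k by (simp add: card_insert_if split: if_splits)
  qed
  consider "g = 1" | "2 \<le> g" "g < k" | "g = k"
    using g dvd_imp_le[OF g(2)] k by linarith
  then show False
  proof cases
    case 1
    obtain i where i: "i < k" "?x i mod k = 0"
      using AP_hits_residue[of k 0 d t] 1 k red by (auto simp: g_def)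
    obtain j where j: "j < k" "?x j mod k = k - 1"
      using AP_hits_residue[of k "k - 1" d t] 1 k red by (auto simp: g_def)
    have "c = 0"
      using col[OF i(1)] i(2) k \<open>c \<noteq> 2\<close>
      by (auto simp: square_coloring_def split: if_splits)
    moreover have "c = 1"
      using col[OF j(1)] j(2) k \<open>c \<noteq> 2\<close>
      by (auto simp: square_coloring_def split: if_splits)
    ultimately show False
      by simp
  next
    case 2
    \<comment> \<open>The leftmost column met is \<open>s\<close> and the rightmost is
      \<open>s + (k - g)\<close>. Being a proper divisor of \<open>k\<close>, \<open>g\<close> is at
      most \<open>k / 2\<close>, which puts them in opposite halves.\<close>
    define s where "s = t mod g"
    have s: "s < g" "int g dvd int s - int t"
      using g(1) by (auto simp: s_def of_nat_mod mod_eq_dvd_iff[symmetric])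
    have "2 * g \<le> k"
      using g(2) 2 by (elim dvdE) (auto simp: nat_mult_le_cancel_disj)
    have "int g dvd (int s - int t) + (int k - int g)"
      using g(2) by (intro dvd_add[OF s(2)] dvd_diff) auto
    then have "int g dvd int (s + (k - g)) - int t"
      using 2 by (simp add: algebra_simps of_nat_diff)
    moreover have "s + (k - g) < k"
      using 2 s by linarith
    ultimately obtain y where y: "y \<in> A" "k \<le> y" "y mod k = s + (k - g)"
      using above 2 by blast
    obtain x where x: "x \<in> A" "k \<le> x" "x mod k = s"
      using above[of s] 2 s by auto
    have "c = 0"
      using mono[OF x(1)] x s \<open>2 * g \<le> k\<close> by (auto simp: square_coloring_def split: if_splits)
    moreover have "c = 1"
      using mono[OF y(1)] y \<open>2 * g \<le> k\<close> by (auto simp: square_coloring_def split: if_splits)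
    ultimately show False
      by simp
  next
    case 3
    define b where "b = t mod k"
    have b: "b < k" "int g dvd int b - int t"
      using k 3 by (auto simp: b_def of_nat_mod mod_eq_dvd_iff[symmetric])
    have "k dvd d"
      using g(3) 3 by simp
    \<comment> \<open>All terms lie in column \<open>b\<close>, which has exactly \<open>k\<close>
      cells, so the \<open>k\<close> terms fill it and include its bottom cell
      \<open>b\<close>.\<close>
    have "?x i \<in> (\<lambda>a. b + k * a) ` {0..<k}" for i
    proof -
      have "?x i mod k = b"
        unfolding red b_def using \<open>k dvd d\<close> by (auto elim!: dvdE simp: mult.left_commute[of i k])
      then have "?x i = b + k * (?x i div k)"
        by (metis mod_mult_div_eq)
      moreover have "?x i div k < k"
        using k by (intro less_mult_imp_div_less) (simp add: power2_eq_square)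
      ultimately show ?thesis
        by (intro image_eqI[of _ _ "?x i div k"]) auto
    qed
    then have "A \<subseteq> (\<lambda>a. b + k * a) ` {0..<k}"
      using A by blast
    moreover have "card ((\<lambda>a. b + k * a) ` {0..<k}) = k"
      using k by (subst card_image) (auto simp: inj_on_def)
    ultimately have "A = (\<lambda>a. b + k * a) ` {0..<k}"
      using card by (intro card_subset_eq) auto
    then have "b \<in> A"
      using k by (auto intro!: image_eqI[of _ _ 0])
    \<comment> \<open>Against the bottom cell \<open>b\<close>, this cell supplies the main colour
      of the same column.\<close>
    obtain x where x: "x \<in> A" "k \<le> x" "x mod k = b"
      using above[of b] b 3 k by auto
    show False
      using mono[OF \<open>b \<in> A\<close>] mono[OF x(1)] x b \<open>c \<noteq> 2\<close>
      by (auto simp: square_coloring_def split: if_splits)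
  qed
qed

theorem proposition4p3:
  fixes k :: nat
  assumes "k \<ge> 3"
  shows "2 \<le> chi (k ^ 2) k \<and> chi (k ^ 2) k \<le> 3"
proof
  show "2 \<le> chi (k ^ 2) k"
    using assms by (intro two_le_chi) (auto simp: power2_eq_square)
  show "chi (k ^ 2) k \<le> 3"
  proof (rule chi_le_coloring[where col = "square_coloring k"])
    show "square_coloring k x < 3" for x
      by (simp add: square_coloring_def)
  next
    fix c d A
    assume "cyclic_AP (k ^ 2) k d A" "A \<subseteq> {x. x < k ^ 2 \<and> square_coloring k x = c}"
    then show False
      using square_coloring_AP_free[OF assms] by blast
  qed
qed

end
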